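(* Let $\mathcal{T}=(t_{ijkl})\in\widehat{\mathcal{E}}_{4,3}$ and suppose $t_{iiij}=0$ for all $i,j\in\{1,2,3\}$ with $i\neq j$. Then $\mathcal{T}$ is positive definite if and only if one of the following conditions is satisfied. (a) $t_{1123}=t_{1223}=t_{1233}=t_{1122}=t_{1133}=t_{2233}=1$. (b) $t_{1123}=t_{1223}=t_{1233}=0$ and $t_{iijj}\in\{0,1\}$ for all $i,j\in\{1,2,3\}$ with $i\neq j$. (c) Two of $t_{1123},t_{1223},t_{1233}$ are $-1$ and the third one is $1$, and $t_{1122}=t_{1133}=t_{2233}=1$. (d) There is a permutation $(i,j,k)$ of $(1,2,3)$ such that $t_{iijk}\in\{-1,1\}$, $t_{ijjk}=t_{ijkk}=0$, $t_{iijj}=t_{iikk}=1$ and $t_{jjkk}\in\{0,1\}$.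
   Context: A 4th order 3-dimensional real tensor $\mathcal{T}=(t_{ijkl})_{i,j,k,l\in\{1,2,3\}}$ is symmetric if its entries are invariant under all permutations of the four indices (so, e.g., $t_{ijjk}$ denotes the common value of all entries whose index multiset is $\{i,j,j,k\}$). $\widehat{\mathcal{E}}_{4,3}$ is the set of symmetric 4th order 3-dimensional tensors all of whose entries lie in $\{-1,0,1\}$ and whose diagonal entries satisfy $t_{1111}=t_{2222}=t_{3333}=1$. For $x\in\mathbb{R}^3$ put $\mathcal{T}x^4=\sum_{i,j,k,l=1}^3 t_{ijkl}x_ix_jx_kx_l$. $\mathcal{T}$ is positive definite if $\mathcal{T}x^4>0$ for all $x\in\mathbb{R}^3\setminus\{0\}$. *)

theory Defs
  imports "HOL-Analysis.Analysis" "HOL-Combinatorics.Permutations"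
begin

type_synonym 'n tensor4 = "'n \<Rightarrow> 'n \<Rightarrow> 'n \<Rightarrow> 'n \<Rightarrow> real"

text \<open>
  An index tuple is a function \<open>f\<close> from the four slots \<open>0, 1, 2, 3\<close> to the index type;
  \<open>p\<close> permutes the slots.
\<close>

definition symmetric_tensor4 :: "'n tensor4 \<Rightarrow> bool" where
  "symmetric_tensor4 t \<longleftrightarrow>
     (\<forall>p (f :: nat \<Rightarrow> 'n). p permutes {0..<4} \<longrightarrow>
        t (f (p 0)) (f (p 1)) (f (p 2)) (f (p 3)) = t (f 0) (f 1) (f 2) (f 3))"

definition tensor4_form :: "('n::finite) tensor4 \<Rightarrow> real ^ 'n \<Rightarrow> real" where
  "tensor4_form t x =
     (\<Sum>i\<in>UNIV. \<Sum>j\<in>UNIV. \<Sum>k\<in>UNIV. \<Sum>l\<in>UNIV. t i j k l * x $ i * x $ j * x $ k * x $ l)"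

definition positive_definite_tensor4 :: "('n::finite) tensor4 \<Rightarrow> bool" where
  "positive_definite_tensor4 t \<longleftrightarrow> (\<forall>x. x \<noteq> 0 \<longrightarrow> tensor4_form t x > 0)"

text \<open>
  In the three-element index type \<open>3\<close> the numeral \<open>3\<close> denotes the same element as \<open>0\<close>,
  so \<open>1\<close>, \<open>2\<close>, \<open>3\<close> are exactly its distinct elements.
\<close>

definition E43_hat :: "3 tensor4 set" where
  "E43_hat = {t. symmetric_tensor4 t \<and>
                 (\<forall>i j k l. t i j k l \<in> {-1, 0, 1}) \<and>
                 t 1 1 1 1 = 1 \<and> t 2 2 2 2 = 1 \<and> t 3 3 3 3 = 1}"

end

theory Submission
  imports Defs
begin

text \<open>
  If all \<open>t\<^sub>i\<^sub>i\<^sub>i\<^sub>j\<close> vanish, the form is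
  \<open>x\<^sup>4 + y\<^sup>4 + z\<^sup>4 + 6 (a x\<^sup>2 y\<^sup>2 + b x\<^sup>2 z\<^sup>2 + c y\<^sup>2 z\<^sup>2) + 12 x y z (p x + q y + r z)\<close>.
  Sufficiency: in every listed case the mixed terms add up to a sum of squares, because
  \<open>(x y + x z + y z)\<^sup>2 = x\<^sup>2 y\<^sup>2 + x\<^sup>2 z\<^sup>2 + y\<^sup>2 z\<^sup>2 + 2 x y z (x + y + z)\<close>, case (c) being case (a)
  after a sign change of one variable, and
  \<open>x\<^sup>2 (y \<plusminus> z)\<^sup>2 = x\<^sup>2 y\<^sup>2 + x\<^sup>2 z\<^sup>2 \<plusminus> 2 x\<^sup>2 y z\<close>.
  Necessity: positivity at the permutations of \<open>(1, 1, 0)\<close> and \<open>(2, \<plusminus>1, \<plusminus>1)\<close> already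
  excludes all other coefficients in \<open>{-1, 0, 1}\<close>.
\<close>

text \<open>The factors 6 and 12 count the arrangements of the index patterns \<open>iijj\<close>
  and \<open>iijk\<close>. Here \<open>a\<close>, \<open>b\<close>, \<open>c\<close> stand for the
  entries 1122, 1133, 2233 and \<open>p\<close>, \<open>q\<close>, \<open>r\<close> for 1123, 1223,
  1233.\<close>

definition ternary_quartic ::
  "real \<Rightarrow> real \<Rightarrow> real \<Rightarrow> real \<Rightarrow> real \<Rightarrow> real \<Rightarrow> real \<Rightarrow> real \<Rightarrow> real \<Rightarrow> real" where
  "ternary_quartic a b c p q r x y z =
     x^4 + y^4 + z^4 + 6 * (a * x\<^sup>2 * y\<^sup>2 + b * x\<^sup>2 * z\<^sup>2 + c * y\<^sup>2 * z\<^sup>2)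
       + 12 * x * y * z * (p * x + q * y + r * z)"

lemma sum_fourth_powers_pos:
  fixes x y z :: real
  assumes "(x, y, z) \<noteq> (0, 0, 0)"
  shows "x^4 + y^4 + z^4 > 0"
proof -
  have nonneg: "u^4 \<ge> 0" for u :: real
    by simp
  have "x^4 > 0 \<or> y^4 > 0 \<or> z^4 > 0"
    using assms by (auto simp: zero_less_power_eq)
  then show ?thesis
    using nonneg[of x] nonneg[of y] nonneg[of z] by linarith
qed

text \<open>The disjuncts are case (b), cases (a) and (c) together, and case (d) with
  \<open>i\<close> equal to 1, 2, 3. Strictness comes from the fourth powers.\<close>

lemma ternary_quartic_pos:
  assumes xyz: "(x, y, z) \<noteq> (0, 0, 0)"
    and coeffs:
      "a \<in> {0, 1} \<and> b \<in> {0, 1} \<and> c \<in> {0, 1} \<and> p = 0 \<and> q = 0 \<and> r = 0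
     \<or> a = 1 \<and> b = 1 \<and> c = 1 \<and> (p, q, r) \<in> {(1, 1, 1), (-1, -1, 1), (-1, 1, -1), (1, -1, -1)}
     \<or> p \<in> {-1, 1} \<and> q = 0 \<and> r = 0 \<and> a = 1 \<and> b = 1 \<and> c \<in> {0, 1}
     \<or> q \<in> {-1, 1} \<and> p = 0 \<and> r = 0 \<and> a = 1 \<and> c = 1 \<and> b \<in> {0, 1}
     \<or> r \<in> {-1, 1} \<and> p = 0 \<and> q = 0 \<and> b = 1 \<and> c = 1 \<and> a \<in> {0, 1}"
  shows "ternary_quartic a b c p q r x y z > 0"
proof -
  let ?rest = "6 * (a * x\<^sup>2 * y\<^sup>2 + b * x\<^sup>2 * z\<^sup>2 + c * y\<^sup>2 * z\<^sup>2)
       + 12 * x * y * z * (p * x + q * y + r * z)"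
  have "?rest \<ge> 0"
    using coeffs
  proof (elim disjE)
    assume "a \<in> {0, 1} \<and> b \<in> {0, 1} \<and> c \<in> {0, 1} \<and> p = 0 \<and> q = 0 \<and> r = 0"
    then show ?thesis
      by auto
  next
    assume "a = 1 \<and> b = 1 \<and> c = 1 \<and>
      (p, q, r) \<in> {(1, 1, 1), (-1, -1, 1), (-1, 1, -1), (1, -1, -1)}"
    \<comment> \<open>The cross terms of the square are
      \<open>2 * x * y * z * (q * r * x + p * r * y + p * q * z)\<close>. All four sign triples have
      product 1, so \<open>q * r = p\<close>, \<open>p * r = q\<close> and
      \<open>p * q = r\<close>.\<close>
    then have "?rest = 6 * (r * x * y + q * x * z + p * y * z)\<^sup>2"
      by (elim conjE) (auto simp: power2_eq_square algebra_simps)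
    then show ?thesis
      by simp
  next
    assume *: "p \<in> {-1, 1} \<and> q = 0 \<and> r = 0 \<and> a = 1 \<and> b = 1 \<and> c \<in> {0, 1}"
    then have "?rest = 6 * (x\<^sup>2 * (y + p * z)\<^sup>2 + c * y\<^sup>2 * z\<^sup>2)"
      by (elim conjE) (auto simp: power2_eq_square algebra_simps)
    also have "\<dots> \<ge> 0"
      using * by auto
    finally show ?thesis .
  next
    assume *: "q \<in> {-1, 1} \<and> p = 0 \<and> r = 0 \<and> a = 1 \<and> c = 1 \<and> b \<in> {0, 1}"
    then have "?rest = 6 * (y\<^sup>2 * (x + q * z)\<^sup>2 + b * x\<^sup>2 * z\<^sup>2)"
      by (elim conjE) (auto simp: power2_eq_square algebra_simps)
    also have "\<dots> \<ge> 0"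
      using * by auto
    finally show ?thesis .
  next
    assume *: "r \<in> {-1, 1} \<and> p = 0 \<and> q = 0 \<and> b = 1 \<and> c = 1 \<and> a \<in> {0, 1}"
    then have "?rest = 6 * (z\<^sup>2 * (x + r * y)\<^sup>2 + a * x\<^sup>2 * y\<^sup>2)"
      by (elim conjE) (auto simp: power2_eq_square algebra_simps)
    also have "\<dots> \<ge> 0"
      using * by auto
    finally show ?thesis .
  qed
  then show ?thesis
    using sum_fourth_powers_pos[OF xyz] by (simp add: ternary_quartic_def)
qed

lemma ternary_quartic_pos_iff:
  assumes coeffs: "a \<in> {-1, 0, 1}" "b \<in> {-1, 0, 1}" "c \<in> {-1, 0, 1}"
      "p \<in> {-1, 0, 1}" "q \<in> {-1, 0, 1}" "r \<in> {-1, 0, 1}"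
  shows "(\<forall>x y z. (x, y, z) \<noteq> (0, 0, 0) \<longrightarrow> ternary_quartic a b c p q r x y z > 0) \<longleftrightarrow>
       a \<in> {0, 1} \<and> b \<in> {0, 1} \<and> c \<in> {0, 1} \<and> p = 0 \<and> q = 0 \<and> r = 0
     \<or> a = 1 \<and> b = 1 \<and> c = 1 \<and> (p, q, r) \<in> {(1, 1, 1), (-1, -1, 1), (-1, 1, -1), (1, -1, -1)}
     \<or> p \<in> {-1, 1} \<and> q = 0 \<and> r = 0 \<and> a = 1 \<and> b = 1 \<and> c \<in> {0, 1}
     \<or> q \<in> {-1, 1} \<and> p = 0 \<and> r = 0 \<and> a = 1 \<and> c = 1 \<and> b \<in> {0, 1}
     \<or> r \<in> {-1, 1} \<and> p = 0 \<and> q = 0 \<and> b = 1 \<and> c = 1 \<and> a \<in> {0, 1}"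
    (is "?pos \<longleftrightarrow> ?cases")
proof
  assume ?pos
  then have pos: "ternary_quartic a b c p q r x y z > 0" if "(x, y, z) \<noteq> (0, 0, 0)" for x y z
    using that by blast
  have "a > -1" "b > -1" "c > -1"
    using pos[of 1 1 0] pos[of 1 0 1] pos[of 0 1 1] by (simp_all add: ternary_quartic_def)
  then have abc: "a \<in> {0, 1}" "b \<in> {0, 1}" "c \<in> {0, 1}"
    using coeffs by auto
  \<comment> \<open>Each inequality is a value of the form divided by 6. The form is even, so four
    sign patterns suffice for each position of the 2.\<close>
  have "3 + 4 * a + 4 * b + c + 8 * p + 4 * q + 4 * r > 0"
    "3 + 4 * a + 4 * b + c - 8 * p + 4 * q - 4 * r > 0"
    "3 + 4 * a + 4 * b + c - 8 * p - 4 * q + 4 * r > 0"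
    "3 + 4 * a + 4 * b + c + 8 * p - 4 * q - 4 * r > 0"
    using pos[of 2 1 1] pos[of 2 "-1" 1] pos[of 2 1 "-1"] pos[of 2 "-1" "-1"]
    by (simp_all add: ternary_quartic_def)
  moreover have "3 + 4 * a + b + 4 * c + 4 * p + 8 * q + 4 * r > 0"
    "3 + 4 * a + b + 4 * c + 4 * p - 8 * q - 4 * r > 0"
    "3 + 4 * a + b + 4 * c - 4 * p - 8 * q + 4 * r > 0"
    "3 + 4 * a + b + 4 * c - 4 * p + 8 * q - 4 * r > 0"
    using pos[of 1 2 1] pos[of "-1" 2 1] pos[of 1 2 "-1"] pos[of "-1" 2 "-1"]
    by (simp_all add: ternary_quartic_def)
  moreover have "3 + a + 4 * b + 4 * c + 4 * p + 4 * q + 8 * r > 0"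
    "3 + a + 4 * b + 4 * c + 4 * p - 4 * q - 8 * r > 0"
    "3 + a + 4 * b + 4 * c - 4 * p + 4 * q - 8 * r > 0"
    "3 + a + 4 * b + 4 * c - 4 * p - 4 * q + 8 * r > 0"
    using pos[of 1 1 2] pos[of "-1" 1 2] pos[of 1 "-1" 2] pos[of "-1" "-1" 2]
    by (simp_all add: ternary_quartic_def)
  \<comment> \<open>Adding the two inequalities with equal sign of \<open>p\<close> cancels
    \<open>q\<close> and \<open>r\<close>, leaving
    \<open>3 + 4 * a + 4 * b + c > 8 * \<bar>p\<bar>\<close>; so \<open>p \<noteq> 0\<close> forces
    \<open>a = b = 1\<close>, and similarly for \<open>q\<close> and \<open>r\<close>. Two nonzero
    values among \<open>p\<close>, \<open>q\<close>, \<open>r\<close> thus force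
    \<open>a = b = c = 1\<close>; then some inequality has left side 12 - 8 - 4 = 0 if the third is
    0, and 12 - 16 < 0 if \<open>p * q * r = -1\<close>.\<close>
  ultimately show ?cases
    using abc coeffs(4-6) by (elim insertE emptyE) simp_all
next
  assume ?cases
  then show ?pos
    by (blast intro: ternary_quartic_pos)
qed

text \<open>Adjacent transpositions generate all permutations of the four slots, so these three
  equations suffice for sorting indices.\<close>

lemma symmetric_tensor4_swaps:
  assumes "symmetric_tensor4 t"
  shows "t j i k l = t i j k l" "t i k j l = t i j k l" "t i j l k = t i j k l"
proof -
  have *: "t (f (p 0)) (f (p 1)) (f (p 2)) (f (p 3)) = t (f 0) (f 1) (f 2) (f 3)"
    if "p permutes {0..<4}" for p and f :: "nat \<Rightarrow> 'a"
    using assms that unfolding symmetric_tensor4_def by blast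
  let ?f = "\<lambda>n::nat. if n = 0 then i else if n = 1 then j else if n = 2 then k else l"
  show "t j i k l = t i j k l" "t i k j l = t i j k l" "t i j l k = t i j k l"
    using *[of "Transposition.transpose 0 1" ?f] *[of "Transposition.transpose 1 2" ?f]
      *[of "Transposition.transpose 2 3" ?f]
    by (simp_all add: permutes_swap_id Transposition.transpose_def)
qed

text \<open>As rewrite rules these equations sort the indices of an entry.\<close>

lemma symmetric_tensor4_sort:
  fixes t :: "3 tensor4"
  assumes "symmetric_tensor4 t"
  shows "t 2 1 k l = t 1 2 k l" "t 3 1 k l = t 1 3 k l" "t 3 2 k l = t 2 3 k l"
    "t k 2 1 l = t k 1 2 l" "t k 3 1 l = t k 1 3 l" "t k 3 2 l = t k 2 3 l"
    "t k l 2 1 = t k l 1 2" "t k l 3 1 = t k l 1 3" "t k l 3 2 = t k l 2 3"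
  by (rule symmetric_tensor4_swaps[OF assms])+

lemma distinct_index3: "(1::3) \<noteq> 2" "(1::3) \<noteq> 3" "(2::3) \<noteq> 3"
  by simp_all

lemma tensor4_form_eq_ternary_quartic:
  fixes t :: "3 tensor4"
  assumes "t \<in> E43_hat"
    and offdiag: "\<And>i j. i \<noteq> j \<Longrightarrow> t i i i j = 0"
  shows "tensor4_form t x =
    ternary_quartic (t 1 1 2 2) (t 1 1 3 3) (t 2 2 3 3) (t 1 1 2 3) (t 1 2 2 3) (t 1 2 3 3)
      (x $ 1) (x $ 2) (x $ 3)"
proof -
  have diag: "t 1 1 1 1 = 1" "t 2 2 2 2 = 1" "t 3 3 3 3 = 1"
    and sym: "symmetric_tensor4 t"
    using assms(1) by (auto simp: E43_hat_def)
  note sort = symmetric_tensor4_sort[OF sym]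
  \<comment> \<open>Stated with sorted indices, the normal form to which \<open>sort\<close> brings
    the 81 summands.\<close>
  have zero: "t 1 1 1 2 = 0" "t 1 1 1 3 = 0" "t 2 2 2 3 = 0"
      "t 1 2 2 2 = 0" "t 1 3 3 3 = 0" "t 2 3 3 3 = 0"
    using offdiag[of 1 2] offdiag[of 1 3] offdiag[of 2 3]
      offdiag[of 2 1] offdiag[of 3 1] offdiag[of 3 2]
    by (simp_all only: sort distinct_index3 distinct_index3[symmetric] simp_thms)
  show ?thesis
    unfolding tensor4_form_def sum_3 sort zero diag ternary_quartic_def
    by algebra
qed

theorem theorem3p1:
  fixes t :: "3 tensor4"
  assumes "t \<in> E43_hat"
    and "\<And>i j. i \<noteq> j \<Longrightarrow> t i i i j = 0"
  shows "positive_definite_tensor4 t \<longleftrightarrow>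
     (t 1 1 2 3 = 1 \<and> t 1 2 2 3 = 1 \<and> t 1 2 3 3 = 1 \<and>
        t 1 1 2 2 = 1 \<and> t 1 1 3 3 = 1 \<and> t 2 2 3 3 = 1)
   \<or> (t 1 1 2 3 = 0 \<and> t 1 2 2 3 = 0 \<and> t 1 2 3 3 = 0 \<and>
        (\<forall>i j. i \<noteq> j \<longrightarrow> t i i j j \<in> {0, 1}))
   \<or> (((t 1 1 2 3 = -1 \<and> t 1 2 2 3 = -1 \<and> t 1 2 3 3 = 1) \<or>
        (t 1 1 2 3 = -1 \<and> t 1 2 2 3 = 1 \<and> t 1 2 3 3 = -1) \<or>
        (t 1 1 2 3 = 1 \<and> t 1 2 2 3 = -1 \<and> t 1 2 3 3 = -1)) \<and>
        t 1 1 2 2 = 1 \<and> t 1 1 3 3 = 1 \<and> t 2 2 3 3 = 1)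
   \<or> (\<exists>i j k. distinct [i, j, k] \<and>
        t i i j k \<in> {-1, 1} \<and> t i j j k = 0 \<and> t i j k k = 0 \<and>
        t i i j j = 1 \<and> t i i k k = 1 \<and> t j j k k \<in> {0, 1})"
proof -
  have entries: "t i j k l \<in> {-1, 0, 1}" for i j k l
    using assms(1) unfolding E43_hat_def by blast
  have sym: "symmetric_tensor4 t"
    using assms(1) by (simp add: E43_hat_def)
  note sort = symmetric_tensor4_sort[OF sym]
  let ?Q = "ternary_quartic (t 1 1 2 2) (t 1 1 3 3) (t 2 2 3 3) (t 1 1 2 3) (t 1 2 2 3) (t 1 2 3 3)"
  have "positive_definite_tensor4 t \<longleftrightarrow>
    (\<forall>x :: real^3. x \<noteq> 0 \<longrightarrow> ?Q (x $ 1) (x $ 2) (x $ 3) > 0)"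
    unfolding positive_definite_tensor4_def
    using tensor4_form_eq_ternary_quartic[OF assms] by simp
  also have "\<dots> \<longleftrightarrow> (\<forall>x y z. (x, y, z) \<noteq> (0, 0, 0) \<longrightarrow> ?Q x y z > 0)"
  proof (intro iffI allI impI)
    fix x y z :: real
    assume "\<forall>x :: real^3. x \<noteq> 0 \<longrightarrow> ?Q (x $ 1) (x $ 2) (x $ 3) > 0"
      and "(x, y, z) \<noteq> (0, 0, 0)"
    then show "?Q x y z > 0"
      by (auto dest!: spec[of _ "vector [x, y, z]"] simp: vec_eq_iff forall_3)
  next
    fix x :: "real^3"
    assume "\<forall>x y z. (x, y, z) \<noteq> (0, 0, 0) \<longrightarrow> ?Q x y z > 0" and "x \<noteq> 0"
    then show "?Q (x $ 1) (x $ 2) (x $ 3) > 0"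
      by (auto simp: vec_eq_iff forall_3)
  qed
  finally have pd_iff: "positive_definite_tensor4 t \<longleftrightarrow>
    (\<forall>x y z. (x, y, z) \<noteq> (0, 0, 0) \<longrightarrow> ?Q x y z > 0)" .
  have ex_3: "(\<exists>i. P i) \<longleftrightarrow> P 1 \<or> P 2 \<or> P 3" for P :: "3 \<Rightarrow> bool"
    using forall_3[of "\<lambda>i. \<not> P i"] by blast
  \<comment> \<open>Of the 27 triples in case (d), six are distinct; exchanging \<open>j\<close> and
    \<open>k\<close> leaves the condition unchanged after sorting, so three disjuncts remain, one
    for each \<open>i\<close>.\<close>
  show ?thesis
    unfolding pd_iff forall_3 ex_3
      ternary_quartic_pos_iff[OF entries entries entries entries entries entries]
    using distinct_index3 distinct_index3[symmetric]
    by (simp only: sort distinct.simps list.set insert_iff empty_iff simp_thms prod.inject) argo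
qed

end
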